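(* For every graph $G$, we have $\alpha\text{-}\mathrm{pw}(s(G)) = \alpha\text{-}\mathrm{pw}(G)+1$.
   Context: All graphs are finite, simple and undirected. For a graph $G$, $\alpha(G)$ denotes the independence number. A path decomposition of $G$ is a pair $(P,\beta)$ where $P$ is a path and $\beta$ assigns to each node $x$ of $P$ a set $\beta(x)\subseteq V(G)$ (a bag) such that every vertex lies in some bag, both endpoints of every edge lie in a common bag, and for every vertex $v$ the nodes whose bags contain $v$ form a subpath of $P$. The $\alpha$-pathwidth (path-independence number) $\alpha\text{-}\mathrm{pw}(G)$ is the minimum, over all path decompositions $(P,\beta)$ of $G$, of $\max_{x\in V(P)} \alpha(G[\beta(x)])$. The s-claw substitution $s(G)$ of $G$ is the graph obtained from the disjoint union of three copies $G_1,G_2,G_3$ of $G$ by adding three new vertices $v_1,v_2,v_3$, making each $v_i$ adjacent to all vertices of $G_i$, and adding a fourth new vertex $w$ adjacent precisely to $v_1,v_2,v_3$. *)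

theory Defs
  imports "Graph_Theory.Graph_Theory" "HOL-Library.Sublist"
begin

text \<open>
  Finite simple undirected graphs are the \<^locale>\<open>pair_graph\<close>s of \<^theory>\<open>Graph_Theory.Pair_Digraph\<close>:
  finite, loop-free digraphs without parallel arcs whose arc relation is symmetric, an edge
  between \<open>u\<close> and \<open>v\<close> being the pair of arcs \<open>(u, v)\<close> and \<open>(v, u)\<close>. The null graph is included.
\<close>

definition independent_set :: "('a, 'b) pre_digraph \<Rightarrow> 'a set \<Rightarrow> bool" where
  "independent_set G S \<longleftrightarrow> S \<subseteq> verts G \<and> (\<forall>u\<in>S. \<forall>v\<in>S. \<not> u \<rightarrow>\<^bsub>G\<^esub> v)"

definition independence_number :: "('a, 'b) pre_digraph \<Rightarrow> nat" where
  "independence_number G = Max {card S | S. independent_set G S}"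

text \<open>
  A path is given by the non-empty list of its distinct nodes in path order, consecutive nodes
  being adjacent; its subpaths are then the non-empty contiguous sublists.
\<close>

definition path_decomposition ::
  "('a, 'b) pre_digraph \<Rightarrow> 'n list \<Rightarrow> ('n \<Rightarrow> 'a set) \<Rightarrow> bool" where
  "path_decomposition G P \<beta> \<longleftrightarrow>
     P \<noteq> [] \<and> distinct P \<and>
     (\<forall>x\<in>set P. \<beta> x \<subseteq> verts G) \<and>
     (\<forall>v\<in>verts G. \<exists>x\<in>set P. v \<in> \<beta> x) \<and>
     (\<forall>u v. u \<rightarrow>\<^bsub>G\<^esub> v \<longrightarrow> (\<exists>x\<in>set P. u \<in> \<beta> x \<and> v \<in> \<beta> x)) \<and>
     (\<forall>v\<in>verts G. \<exists>Q. Q \<noteq> [] \<and> sublist Q P \<and> set Q = {x \<in> set P. v \<in> \<beta> x})"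

definition decomposition_alpha ::
  "('a, 'b) pre_digraph \<Rightarrow> 'n list \<Rightarrow> ('n \<Rightarrow> 'a set) \<Rightarrow> nat" where
  "decomposition_alpha G P \<beta> = Max ((\<lambda>x. independence_number (G \<restriction> \<beta> x)) ` set P)"

text \<open>
  Nodes can be taken to be natural numbers, since only finitely many are used and renaming them
  changes nothing.
\<close>

definition alpha_pw :: "('a, 'b) pre_digraph \<Rightarrow> nat" where
  "alpha_pw G = (LEAST k. \<exists>(P :: nat list) \<beta>.
     path_decomposition G P \<beta> \<and> decomposition_alpha G P \<beta> = k)"

lemma alpha_pw_attained:
  assumes "wf_digraph G"
  shows "\<exists>(P :: nat list) \<beta>. path_decomposition G P \<beta> \<and> decomposition_alpha G P \<beta> = alpha_pw G"
proof -
  interpret wf_digraph G by fact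
  have "\<exists>Q. Q \<noteq> [] \<and> sublist Q [0::nat] \<and> set Q = {x \<in> set [0]. v \<in> verts G}"
    if "v \<in> verts G" for v
    using that by (intro exI[of _ "[0]"]) simp
  moreover have "u \<in> verts G \<and> v \<in> verts G" if "u \<rightarrow>\<^bsub>G\<^esub> v" for u v
    using adj_in_verts[OF that] by blast
  ultimately have "path_decomposition G [0::nat] (\<lambda>_. verts G)"
    unfolding path_decomposition_def by (intro conjI) (simp_all, blast?)
  then show ?thesis
    unfolding alpha_pw_def
    by (intro LeastI_ex[of "\<lambda>k. \<exists>(P :: nat list) \<beta>.
          path_decomposition G P \<beta> \<and> decomposition_alpha G P \<beta> = k"]) blast
qed

text \<open>
  For \<open>i \<in> {1, 2, 3}\<close>, \<open>Copy i u\<close> is the vertex of the copy \<open>G\<^sub>i\<close> corresponding to \<open>u\<close> and \<open>Apex i\<close>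
  is \<open>v\<^sub>i\<close>; \<open>Center\<close> is \<open>w\<close>.
\<close>

datatype 'a s_vertex = Copy nat 'a | Apex nat | Center

definition s_claw :: "'a pair_pre_digraph \<Rightarrow> 'a s_vertex pair_pre_digraph" where
  "s_claw G =
    (let E = {(Copy i u, Copy i v) | i u v. i \<in> {1, 2, 3} \<and> (u, v) \<in> parcs G}
           \<union> {(Apex i, Copy i u) | i u. i \<in> {1, 2, 3} \<and> u \<in> pverts G}
           \<union> {(Center, Apex i) | i. i \<in> {1, 2, 3}}
     in \<lparr> pverts = {Copy i u | i u. i \<in> {1, 2, 3} \<and> u \<in> pverts G} \<union> Apex ` {1, 2, 3} \<union> {Center},
          parcs = E \<union> E\<inverse> \<rparr>)"

lemma pair_graph_s_claw:
  assumes "pair_graph G"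
  shows "pair_graph (s_claw G)"
proof -
  interpret pair_graph G by fact
  obtain I where I: "I = {1, 2, 3 :: nat}" by blast
  obtain E where E: "E = {(Copy i u, Copy i v) | i u v. i \<in> I \<and> (u, v) \<in> parcs G}
      \<union> {(Apex i, Copy i u) | i u. i \<in> I \<and> u \<in> pverts G} \<union> {(Center, Apex i) | i. i \<in> I}"
    by blast
  let ?V = "{Copy i u | i u. i \<in> I \<and> u \<in> pverts G} \<union> Apex ` I \<union> {Center}"
  have V: "pverts (s_claw G) = ?V" and A: "parcs (s_claw G) = E \<union> E\<inverse>"
    by (simp_all only: s_claw_def Let_def I E pair_pre_digraph.simps)
  have "?V = (\<lambda>(i, u). Copy i u) ` (I \<times> pverts G) \<union> Apex ` I \<union> {Center}"
    by auto
  then have fin: "finite ?V"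
    using pair_finite_verts by (simp add: I)
  have "E \<subseteq> ?V \<times> ?V"
    unfolding E by (auto dest: in_arcsD1 in_arcsD2)
  then have sub: "E \<union> E\<inverse> \<subseteq> ?V \<times> ?V"
    by blast
  have ne: "fst e \<noteq> snd e" if "e \<in> E" for e
    using that unfolding E by (auto dest: pair_no_loops)
  show ?thesis
  proof
    show "fst e \<in> pverts (s_claw G)" "snd e \<in> pverts (s_claw G)"
      if "e \<in> parcs (s_claw G)" for e
      using that subsetD[OF sub, of e] unfolding V A by (simp_all only: mem_Times_iff)
    show "finite (pverts (s_claw G))" unfolding V by (rule fin)
    show "finite (parcs (s_claw G))"
      unfolding A by (rule finite_subset[OF sub finite_cartesian_product[OF fin fin]])
    show "fst e \<noteq> snd e" if "e \<in> parcs (s_claw G)" for e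
      using that ne[of e] ne[of "prod.swap e"] unfolding A by (cases e) auto
    show "symmetric (s_claw G)"
      unfolding symmetric_def with_proj_simps A by (rule sym_Un_converse)
  qed
qed

end

theory Submission
  imports Defs
begin

text \<open>
  For the upper bound, lay a decomposition of \<open>G\<close> out three times in a row, once per copy, and add
  \<open>v\<^sub>i\<close> and \<open>w\<close> to all bags of the \<open>i\<close>-th block: an independent set of such a bag is \<open>{v\<^sub>i}\<close>, or an
  independent set of a bag of \<open>G\<close> with possibly \<open>w\<close> added.

  For the lower bound, a decomposition of \<open>s(G)\<close> restricts to a decomposition of each copy, so
  for each \<open>i\<close> some bag contains \<open>\<alpha>-pw(G)\<close> independent vertices of \<open>G\<^sub>i\<close>. The middle one of these
  three bags, say for \<open>G\<^sub>b\<close>, separates the other two, which are joined by a walk through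
  \<open>G\<^sub>a, v\<^sub>a, w, v\<^sub>c, G\<^sub>c\<close>. Hence the middle bag contains a vertex of this walk, and no vertex of the
  walk has a neighbour in \<open>G\<^sub>b\<close>.
\<close>

section \<open>Independence numbers\<close>

text \<open>The induced subgraph has vertex set \<open>B\<close> itself and keeps all arcs inside
  \<open>B\<close>, so bags can be handled through adjacency in \<open>G\<close>.\<close>

lemma independent_set_induce_iff:
  "independent_set (G \<restriction> B) S \<longleftrightarrow> S \<subseteq> B \<and> (\<forall>u\<in>S. \<forall>v\<in>S. \<not> u \<rightarrow>\<^bsub>G\<^esub> v)"
  unfolding independent_set_def induce_subgraph_def arcs_ends_def arc_to_ends_def
  by auto blast

lemma finite_independent_cards:
  assumes "finite (verts G)"
  shows "finite {card S | S. independent_set G S}"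
proof -
  have "{card S | S. independent_set G S} \<subseteq> card ` Pow (verts G)"
    unfolding independent_set_def by blast
  with assms show ?thesis
    by (meson finite_Pow_iff finite_imageI finite_subset)
qed

lemma card_le_independence_number:
  assumes "finite (verts G)" "independent_set G S"
  shows "card S \<le> independence_number G"
  unfolding independence_number_def
  using assms by (intro Max_ge finite_independent_cards) auto

lemma independence_number_attained:
  assumes "finite (verts G)"
  obtains S where "independent_set G S" "card S = independence_number G"
proof -
  have "independent_set G {}"
    by (simp add: independent_set_def)
  then have "{card S | S. independent_set G S} \<noteq> {}"
    by blast
  from Max_in[OF finite_independent_cards[OF assms] this] show ?thesis
    unfolding independence_number_def[symmetric] using that by auto
qed

section \<open>Path decompositions\<close>

lemma path_decomposition_map:
  assumes "path_decomposition G P \<beta>" and inj: "inj_on f (set P)"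
  shows "path_decomposition G (map f P) (\<beta> \<circ> the_inv_into (set P) f)"
proof -
  have g: "the_inv_into (set P) f (f x) = x" if "x \<in> set P" for x
    using the_inv_into_f_f[OF inj that] .
  have "\<exists>Q'. Q' \<noteq> [] \<and> sublist Q' (map f P) \<and>
          set Q' = {y \<in> set (map f P). v \<in> (\<beta> \<circ> the_inv_into (set P) f) y}"
    if v: "v \<in> verts G" for v
  proof -
    obtain Q where Q: "Q \<noteq> []" "sublist Q P" "set Q = {x \<in> set P. v \<in> \<beta> x}"
      using assms(1) v unfolding path_decomposition_def by meson
    then show ?thesis
      using g by (intro exI[of _ "map f Q"]) (auto intro: map_mono_sublist)
  qed
  then show ?thesis
    using assms g unfolding path_decomposition_def by (simp add: distinct_map)
qed

lemma decomposition_alpha_map: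
  assumes "inj_on f (set P)"
  shows "decomposition_alpha G (map f P) (\<beta> \<circ> the_inv_into (set P) f) = decomposition_alpha G P \<beta>"
proof -
  have "the_inv_into (set P) f (f x) = x" if "x \<in> set P" for x
    using the_inv_into_f_f[OF assms that] .
  then show ?thesis
    unfolding decomposition_alpha_def by (simp add: image_image)
qed

text \<open>\<open>alpha_pw\<close> minimises over nodes of type \<open>nat\<close>. An injective
  renaming into \<open>nat\<close> keeps the width, so nodes of any type may be used, such as the
  pairs in the upper bound.\<close>

lemma alpha_pw_le:
  assumes "path_decomposition G P \<beta>"
  shows "alpha_pw G \<le> decomposition_alpha G P \<beta>"
proof -
  obtain f :: "_ \<Rightarrow> nat" where "inj_on f (set P)"
    using finite_imp_inj_to_nat_seg[of "set P"] by blast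
  from path_decomposition_map[OF assms this] decomposition_alpha_map[OF this, of G \<beta>]
  show ?thesis
    unfolding alpha_pw_def by (intro Least_le) blast
qed

text \<open>The maxima over bags and over independent sets are both attained. With
  \<open>card_le_decomposition_alpha\<close>, later arguments need only speak of independent sets of
  \<open>G\<close> inside bags.\<close>

lemma decomposition_alpha_attained:
  assumes "path_decomposition G P \<beta>" "finite (verts G)"
  obtains x S where "x \<in> set P" "S \<subseteq> \<beta> x" "\<forall>u\<in>S. \<forall>v\<in>S. \<not> u \<rightarrow>\<^bsub>G\<^esub> v"
    "card S = decomposition_alpha G P \<beta>"
proof -
  have "decomposition_alpha G P \<beta> \<in> (\<lambda>x. independence_number (G \<restriction> \<beta> x)) ` set P"
    unfolding decomposition_alpha_def using assms(1)
    by (intro Max_in) (auto simp: path_decomposition_def)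
  then obtain x where x: "x \<in> set P" "independence_number (G \<restriction> \<beta> x) = decomposition_alpha G P \<beta>"
    by auto
  have "finite (verts (G \<restriction> \<beta> x))"
    using assms x(1) by (auto simp: path_decomposition_def intro: finite_subset)
  then obtain S where "independent_set (G \<restriction> \<beta> x) S" "card S = independence_number (G \<restriction> \<beta> x)"
    by (rule independence_number_attained)
  with x that show ?thesis
    by (auto simp: independent_set_induce_iff)
qed

lemma card_le_decomposition_alpha:
  assumes "path_decomposition G P \<beta>" "finite (verts G)"
    and "x \<in> set P" "S \<subseteq> \<beta> x" "\<forall>u\<in>S. \<forall>v\<in>S. \<not> u \<rightarrow>\<^bsub>G\<^esub> v"
  shows "card S \<le> decomposition_alpha G P \<beta>"
proof -
  have "finite (verts (G \<restriction> \<beta> x))"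
    using assms(1-3) by (auto simp: path_decomposition_def intro: finite_subset)
  then have "card S \<le> independence_number (G \<restriction> \<beta> x)"
    using assms(4,5) by (intro card_le_independence_number) (simp_all add: independent_set_induce_iff)
  also have "\<dots> \<le> decomposition_alpha G P \<beta>"
    unfolding decomposition_alpha_def using assms(3) by simp
  finally show ?thesis .
qed

text \<open>A vertex \<open>v\<close> of \<open>G\<close> occupies exactly the nodes that
  \<open>f v\<close> occupies, so contiguity carries over. The map of interest is
  \<open>Copy i\<close>.\<close>

lemma path_decomposition_vimage:
  assumes "path_decomposition H P \<beta>" "wf_digraph G"
    and verts: "\<And>v. v \<in> verts G \<Longrightarrow> f v \<in> verts H"
    and adj: "\<And>u v. u \<rightarrow>\<^bsub>G\<^esub> v \<Longrightarrow> f u \<rightarrow>\<^bsub>H\<^esub> f v"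
  shows "path_decomposition G P (\<lambda>x. f -` \<beta> x \<inter> verts G)"
proof -
  interpret wf_digraph G by fact
  have "\<exists>Q. Q \<noteq> [] \<and> sublist Q P \<and> set Q = {x \<in> set P. v \<in> f -` \<beta> x \<inter> verts G}"
    if "v \<in> verts G" for v
    using assms(1) verts[OF that] that unfolding path_decomposition_def by simp
  moreover have "\<exists>x\<in>set P. u \<in> f -` \<beta> x \<inter> verts G \<and> v \<in> f -` \<beta> x \<inter> verts G"
    if "u \<rightarrow>\<^bsub>G\<^esub> v" for u v
    using assms(1) adj[OF that] adj_in_verts[OF that] unfolding path_decomposition_def by simp
  ultimately show ?thesis
    using assms(1) verts unfolding path_decomposition_def by auto
qed

text \<open>The nodes containing \<open>v\<close> form a contiguous sublist, hence an interval of
  positions, as distinctness makes the position of a node unique.\<close>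

lemma path_decomposition_between:
  assumes "path_decomposition G P \<beta>" "v \<in> \<beta> (P ! i)" "v \<in> \<beta> (P ! k)"
    and "i \<le> j" "j \<le> k" "k < length P"
  shows "v \<in> \<beta> (P ! j)"
proof -
  have "distinct P" and "v \<in> verts G"
    using assms unfolding path_decomposition_def by (auto simp: in_mono)
  then obtain xs Q ys where P: "P = xs @ Q @ ys" and Q: "set Q = {x \<in> set P. v \<in> \<beta> x}"
    using assms(1) unfolding path_decomposition_def sublist_def by metis
  have index: "n \<in> {length xs..<length xs + length Q}"
    if n: "n < length P" "v \<in> \<beta> (P ! n)" for n
  proof -
    have "P ! n \<in> set Q"
      using n Q by simp
    then obtain m where m: "m < length Q" "P ! n = Q ! m"
      by (metis in_set_conv_nth)
    then have "P ! n = P ! (length xs + m)"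
      by (simp add: P nth_append)
    moreover have "length xs + m < length P"
      using m(1) by (simp add: P)
    ultimately have "n = length xs + m"
      using nth_eq_iff_index_eq[OF \<open>distinct P\<close> n(1)] by blast
    with m(1) show ?thesis by simp
  qed
  have "length xs \<le> j" "j - length xs < length Q"
    using index[of i] index[of k] assms by auto
  then have "P ! j \<in> set Q"
    by (simp add: P nth_append)
  with Q show ?thesis by blast
qed

text \<open>Every bag separates the vertices occurring before it from those occurring after it.\<close>

lemma path_decomposition_separates:
  assumes "path_decomposition G P \<beta>"
    and "(u, v) \<in> (Restr (arcs_ends G) C)\<^sup>*" "u \<in> C"
    and "u \<in> \<beta> (P ! i)" "v \<in> \<beta> (P ! k)" "i \<le> j" "j \<le> k" "k < length P"
  shows "\<beta> (P ! j) \<inter> C \<noteq> {}"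
proof
  assume avoid: "\<beta> (P ! j) \<inter> C = {}"
  \<comment> \<open>Invariant along the walk: while bag \<open>j\<close> is avoided, each vertex
    reached still occurs at or before position \<open>j\<close>.\<close>
  from assms(2) have "v \<in> C \<and> (\<exists>l\<le>j. v \<in> \<beta> (P ! l))"
  proof induction
    case base
    with assms show ?case by blast
  next
    case (step y z)
    then obtain l where l: "l \<le> j" "y \<in> \<beta> (P ! l)" by blast
    from step have yz: "y \<rightarrow>\<^bsub>G\<^esub> z" "y \<in> C" "z \<in> C" by auto
    then obtain m where m: "m < length P" "y \<in> \<beta> (P ! m)" "z \<in> \<beta> (P ! m)"
      using assms(1) unfolding path_decomposition_def by (metis in_set_conv_nth)
    \<comment> \<open>Otherwise \<open>y\<close> would occur on both sides of \<open>j\<close>,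
      hence in bag \<open>j\<close> itself.\<close>
    have "m \<le> j"
    proof (rule ccontr)
      assume "\<not> m \<le> j"
      then have "y \<in> \<beta> (P ! j)"
        using path_decomposition_between[OF assms(1) l(2) m(2) l(1)] m(1) by simp
      with avoid yz(2) show False by blast
    qed
    with m yz(3) show ?case by blast
  qed
  then obtain l where "v \<in> C" "l \<le> j" "v \<in> \<beta> (P ! l)" by blast
  with path_decomposition_between[OF assms(1) this(3) assms(5)] assms(7,8) avoid
  show False by blast
qed

section \<open>The s-claw substitution\<close>

lemma pverts_s_claw_iff:
  "Copy i u \<in> pverts (s_claw G) \<longleftrightarrow> i \<in> {1, 2, 3} \<and> u \<in> pverts G"
  "Apex i \<in> pverts (s_claw G) \<longleftrightarrow> i \<in> {1, 2, 3}"
  "Center \<in> pverts (s_claw G)"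
  by (auto simp: s_claw_def Let_def)

lemma parcs_s_claw_iff:
  assumes "pair_graph G"
  shows "(Copy i u, Copy j v) \<in> parcs (s_claw G) \<longleftrightarrow> i = j \<and> i \<in> {1, 2, 3} \<and> (u, v) \<in> parcs G"
    "(Apex i, Copy j u) \<in> parcs (s_claw G) \<longleftrightarrow> i = j \<and> i \<in> {1, 2, 3} \<and> u \<in> pverts G"
    "(Copy j u, Apex i) \<in> parcs (s_claw G) \<longleftrightarrow> i = j \<and> i \<in> {1, 2, 3} \<and> u \<in> pverts G"
    "(Center, Apex i) \<in> parcs (s_claw G) \<longleftrightarrow> i \<in> {1, 2, 3}"
    "(Apex i, Center) \<in> parcs (s_claw G) \<longleftrightarrow> i \<in> {1, 2, 3}"
    "(Apex i, Apex j) \<notin> parcs (s_claw G)"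
    "(Copy i u, Center) \<notin> parcs (s_claw G)"
    "(Center, Copy i u) \<notin> parcs (s_claw G)"
    "(Center, Center) \<notin> parcs (s_claw G)"
proof -
  interpret pair_graph G by fact
  \<comment> \<open>Copied arcs come with their converses, so symmetry of \<open>G\<close> is what
    recovers the arcs inside a copy.\<close>
  have "(v, u) \<in> parcs G \<longleftrightarrow> (u, v) \<in> parcs G"
    using arcs_symmetric by blast
  then show "(Copy i u, Copy j v) \<in> parcs (s_claw G) \<longleftrightarrow>
      i = j \<and> i \<in> {1, 2, 3} \<and> (u, v) \<in> parcs G"
    by (auto simp: s_claw_def Let_def)
qed (auto simp: s_claw_def Let_def)

section \<open>Upper bound by three consecutive copies of a decomposition\<close>

lemma alpha_pw_s_claw_le:
  fixes G :: "'a pair_pre_digraph"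
  assumes G: "pair_graph G"
  shows "alpha_pw (with_proj (s_claw G)) \<le> alpha_pw (with_proj G) + 1"
proof -
  interpret G: pair_graph G by fact
  interpret S: pair_graph "s_claw G" using G by (rule pair_graph_s_claw)
  have fin: "finite (verts G)" "finite (verts (s_claw G))" by simp_all
  obtain P :: "nat list" and \<beta> where dec: "path_decomposition G P \<beta>"
    and alpha: "decomposition_alpha G P \<beta> = alpha_pw G"
    using alpha_pw_attained[OF G.wf_digraph] by blast
  \<comment> \<open>\<open>List.product\<close> runs through all pairs starting with 1, then 2, then
    3, which gives the three blocks in a row with distinct nodes.\<close>
  define P' where "P' = List.product [1, 2, 3::nat] P"
  define \<beta>' where "\<beta>' = (\<lambda>(i, x). insert Center (insert (Apex i) (Copy i ` \<beta> x)))"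
  have P': "set P' = {1, 2, 3} \<times> set P"
    by (auto simp: P'_def)
  have block: "sublist (map (Pair i) P) P'" if "i \<in> {1, 2, 3}" for i
  proof -
    have "P' = map (Pair 1) P @ map (Pair 2) P @ map (Pair 3) P"
      by (simp add: P'_def)
    with that show ?thesis
      using sublist_appendI[of "map (Pair (1::nat)) P" "[]"]
        sublist_appendI[of "map (Pair (2::nat)) P" "map (Pair 1) P"]
        sublist_appendI[of "map (Pair (3::nat)) P" "map (Pair 1) P @ map (Pair 2) P" "[]"]
      by auto
  qed
  have "P \<noteq> []" using dec by (simp add: path_decomposition_def)
  have bags: "\<beta> x \<subseteq> pverts G" if "x \<in> set P" for x
    using dec that by (simp add: path_decomposition_def)
  have dec': "path_decomposition (s_claw G) P' \<beta>'"
    unfolding path_decomposition_def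
  proof (intro conjI ballI allI impI)
    show "P' \<noteq> []" using \<open>P \<noteq> []\<close> by (simp add: P'_def)
    show "distinct P'"
      using dec unfolding P'_def path_decomposition_def by (intro distinct_product) auto
    show "\<beta>' n \<subseteq> verts (s_claw G)" if "n \<in> set P'" for n
      using that by (auto simp: P' \<beta>'_def pverts_s_claw_iff dest: subsetD[OF bags])
    \<comment> \<open>A copy vertex occupies a stretch of one block, an apex a whole block, and
      \<open>Center\<close> all of \<open>P'\<close>.\<close>
    have "\<exists>Q. Q \<noteq> [] \<and> sublist Q P' \<and> set Q = {n \<in> set P'. v \<in> \<beta>' n}"
      if v: "v \<in> verts (s_claw G)" for v
    proof (cases v)
      case (Copy i u)
      with v have i: "i \<in> {1, 2, 3}" and u: "u \<in> verts G"
        by (simp_all add: pverts_s_claw_iff)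
      obtain Q where Q: "Q \<noteq> []" "sublist Q P" "set Q = {x \<in> set P. u \<in> \<beta> x}"
        using dec u unfolding path_decomposition_def by meson
      have "sublist (map (Pair i) Q) P'"
        using map_mono_sublist[OF Q(2)] block[OF i] by (rule sublist_order.order_trans)
      moreover have "set (map (Pair i) Q) = {n \<in> set P'. v \<in> \<beta>' n}"
        using i Q(3) by (auto simp: P' \<beta>'_def Copy)
      ultimately show ?thesis
        using Q(1) by (intro exI[of _ "map (Pair i) Q"]) simp
    next
      case (Apex i)
      with v have i: "i \<in> {1, 2, 3}"
        by (simp add: pverts_s_claw_iff)
      have "set (map (Pair i) P) = {n \<in> set P'. v \<in> \<beta>' n}"
        using i by (auto simp: P' \<beta>'_def Apex)
      then show ?thesis
        using block[OF i] \<open>P \<noteq> []\<close> by (intro exI[of _ "map (Pair i) P"]) simp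
    next
      case Center
      have "set P' = {n \<in> set P'. v \<in> \<beta>' n}"
        by (auto simp: \<beta>'_def Center)
      then show ?thesis
        using \<open>P' \<noteq> []\<close> by (intro exI[of _ P']) simp
    qed
    note conn = this
    show "\<exists>Q. Q \<noteq> [] \<and> sublist Q P' \<and> set Q = {n \<in> set P'. v \<in> \<beta>' n}"
      if "v \<in> verts (s_claw G)" for v
      using conn[OF that] .
    show "\<exists>n\<in>set P'. v \<in> \<beta>' n" if v: "v \<in> verts (s_claw G)" for v
    proof -
      obtain Q where "Q \<noteq> []" "set Q = {n \<in> set P'. v \<in> \<beta>' n}"
        using conn[OF v] by blast
      then show ?thesis
        by (metis (mono_tags, lifting) empty_Collect_eq set_empty)
    qed
    have covers: "\<exists>x\<in>set P. u \<in> \<beta> x" if "u \<in> pverts G" for u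
      using dec that by (simp add: path_decomposition_def)
    have covers_arc: "\<exists>x\<in>set P. u \<in> \<beta> x \<and> v \<in> \<beta> x" if "(u, v) \<in> parcs G" for u v
      using dec that by (simp add: path_decomposition_def)
    \<comment> \<open>The edge between \<open>Center\<close> and \<open>Apex i\<close> lies in every
      bag of block \<open>i\<close>; only the existence of a node is needed there.\<close>
    have ex: "\<exists>x. x \<in> set P" using \<open>P \<noteq> []\<close> by (simp add: ex_in_conv)
    show "\<exists>n\<in>set P'. u \<in> \<beta>' n \<and> v \<in> \<beta>' n" if uv: "u \<rightarrow>\<^bsub>s_claw G\<^esub> v" for u v
    proof -
      have "(u, v) \<in> parcs (s_claw G)" using uv by simp
      then have "\<exists>i\<in>{1, 2, 3}. \<exists>x\<in>set P. u \<in> \<beta>' (i, x) \<and> v \<in> \<beta>' (i, x)"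
        by (cases u; cases v)
          (use covers covers_arc ex in \<open>auto simp: parcs_s_claw_iff[OF G] \<beta>'_def image_iff\<close>)
      then show ?thesis unfolding P' by blast
    qed
  qed
  obtain n S where "n \<in> set P'" and S: "S \<subseteq> \<beta>' n" "\<forall>u\<in>S. \<forall>v\<in>S. \<not> u \<rightarrow>\<^bsub>s_claw G\<^esub> v"
    and card: "card S = decomposition_alpha (s_claw G) P' \<beta>'"
    using decomposition_alpha_attained[OF dec' fin(2)] by blast
  then obtain i x where n: "n = (i, x)" "i \<in> {1, 2, 3}" "x \<in> set P"
    unfolding P' by blast
  note x = bags[OF n(3)]
  have "card S \<le> alpha_pw G + 1"
  proof (cases "Apex i \<in> S")
    case True
    \<comment> \<open>Every other vertex of this bag is a neighbour of
      \<open>Apex i\<close>.\<close>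
    have "y = Apex i" if "y \<in> S" for y
    proof -
      have "(Apex i, y) \<notin> parcs (s_claw G)" "y \<in> \<beta>' (i, x)"
        using that True S by (auto simp: n)
      then show ?thesis
        using n(2) x by (auto simp: \<beta>'_def parcs_s_claw_iff[OF G])
    qed
    then have "S \<subseteq> {Apex i}" by blast
    from card_mono[OF _ this] show ?thesis by simp
  next
    case False
    \<comment> \<open>With the apex excluded, \<open>S\<close> consists of its part in the copy and
      possibly \<open>Center\<close>.\<close>
    define T where "T = Copy i -` S"
    have "T \<subseteq> \<beta> x"
      using S(1) by (auto simp: T_def n(1) \<beta>'_def)
    moreover have "(u, v) \<notin> parcs G" if "u \<in> T" "v \<in> T" for u v
    proof -
      have "(Copy i u, Copy i v) \<notin> parcs (s_claw G)"
        using S(2) that by (simp add: T_def)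
      with n(2) show ?thesis
        by (simp add: parcs_s_claw_iff[OF G])
    qed
    ultimately have T: "T \<subseteq> \<beta> x" "\<forall>u\<in>T. \<forall>v\<in>T. \<not> u \<rightarrow>\<^bsub>G\<^esub> v"
      by simp_all
    have "finite T"
      using T(1) x G.pair_finite_verts by (meson finite_subset)
    have "S \<subseteq> insert Center (Copy i ` T)"
      using S(1) False by (auto simp: T_def n(1) \<beta>'_def)
    then have "card S \<le> card (insert Center (Copy i ` T))"
      using \<open>finite T\<close> by (simp add: card_mono)
    also have "\<dots> \<le> card T + 1"
      using \<open>finite T\<close> by (auto simp: card_insert_if card_image_le)
    also have "card T \<le> alpha_pw G"
      using card_le_decomposition_alpha[OF dec fin(1) n(3) T] alpha by simp
    finally show ?thesis by simp
  qed
  with card alpha_pw_le[OF dec'] show ?thesis by simp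
qed

section \<open>Lower bound by separation at the middle bag\<close>

lemma median_of_three:
  fixes f :: "nat \<Rightarrow> 'b::linorder"
  obtains a b c where "{a, b, c} = {1, 2, 3}" "a \<noteq> b" "b \<noteq> c" "f a \<le> f b" "f b \<le> f c"
proof -
  consider "f 1 \<le> f 2" "f 2 \<le> f 3" | "f 1 \<le> f 3" "f 3 \<le> f 2" | "f 2 \<le> f 1" "f 1 \<le> f 3"
    | "f 2 \<le> f 3" "f 3 \<le> f 1" | "f 3 \<le> f 1" "f 1 \<le> f 2" | "f 3 \<le> f 2" "f 2 \<le> f 1"
    by (meson linear)
  then show thesis
  proof cases
    case 1 then show ?thesis by (intro that[of 1 2 3]) auto
  next
    case 2 then show ?thesis by (intro that[of 1 3 2]) auto
  next
    case 3 then show ?thesis by (intro that[of 2 1 3]) auto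
  next
    case 4 then show ?thesis by (intro that[of 2 3 1]) auto
  next
    case 5 then show ?thesis by (intro that[of 3 1 2]) auto
  next
    case 6 then show ?thesis by (intro that[of 3 2 1]) auto
  qed
qed

lemma alpha_pw_s_claw_ge:
  fixes G :: "'a pair_pre_digraph"
  assumes G: "pair_graph G"
  shows "alpha_pw (with_proj G) + 1 \<le> alpha_pw (with_proj (s_claw G))"
proof -
  interpret G: pair_graph G by fact
  interpret S: pair_graph "s_claw G" using G by (rule pair_graph_s_claw)
  have fin: "finite (verts G)" "finite (verts (s_claw G))" by simp_all
  obtain P :: "nat list" and \<beta> where dec: "path_decomposition (s_claw G) P \<beta>"
    and alpha: "decomposition_alpha (s_claw G) P \<beta> = alpha_pw (s_claw G)"
    using alpha_pw_attained[OF S.wf_digraph] by blast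
  have independent_card_le: "card S \<le> alpha_pw (s_claw G)"
    if "x \<in> set P" "S \<subseteq> \<beta> x" "\<And>u v. u \<in> S \<Longrightarrow> v \<in> S \<Longrightarrow> (u, v) \<notin> parcs (s_claw G)" for x S
    using card_le_decomposition_alpha[OF dec fin(2) that(1,2)] that(3) alpha by simp
  \<comment> \<open>One predicate for all requirements, so that \<open>p\<close> and
    \<open>T\<close> can be chosen for the three copies at once.\<close>
  define good where "good i p T \<longleftrightarrow> p < length P \<and> Copy i ` T \<subseteq> \<beta> (P ! p) \<and> finite T \<and>
      (\<forall>u\<in>T. \<forall>v\<in>T. (u, v) \<notin> parcs G) \<and> alpha_pw G \<le> card T" for i p T
  have "\<exists>p T. good i p T" if i: "i \<in> {1, 2, 3}" for i
  proof -
    \<comment> \<open>The trace of the decomposition on copy \<open>i\<close> decomposes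
      \<open>G\<close>, so some bag attains a width of at least \<open>alpha_pw G\<close>.\<close>
    have dec_i: "path_decomposition G P (\<lambda>x. Copy i -` \<beta> x \<inter> verts G)"
      using i by (intro path_decomposition_vimage[OF dec G.wf_digraph])
        (auto simp: pverts_s_claw_iff parcs_s_claw_iff[OF G])
    obtain x T where "x \<in> set P" "T \<subseteq> Copy i -` \<beta> x \<inter> verts G" "\<forall>u\<in>T. \<forall>v\<in>T. \<not> u \<rightarrow>\<^bsub>G\<^esub> v"
      "card T = decomposition_alpha G P (\<lambda>x. Copy i -` \<beta> x \<inter> verts G)"
      using decomposition_alpha_attained[OF dec_i fin(1)] by blast
    moreover from this have "finite T"
      using fin(1) by (meson finite_subset le_inf_iff)
    moreover obtain p where "p < length P" "x = P ! p"
      using \<open>x \<in> set P\<close> by (metis in_set_conv_nth)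
    ultimately show ?thesis
      using alpha_pw_le[OF dec_i] unfolding good_def by (intro exI[of _ p] exI[of _ T]) auto
  qed
  then obtain p T where "good i (p i) (T i)" if "i \<in> {1, 2, 3}" for i
    by metis
  then have pT: "p i < length P" "Copy i ` T i \<subseteq> \<beta> (P ! p i)" "finite (T i)"
      "\<forall>u\<in>T i. \<forall>v\<in>T i. (u, v) \<notin> parcs G" "alpha_pw G \<le> card (T i)"
      if "i \<in> {1, 2, 3}" for i
    using that unfolding good_def by blast+
  show ?thesis
  proof (cases "alpha_pw G = 0")
    case True
    \<comment> \<open>Here the sets \<open>T i\<close> may be empty and give no endpoints for a
      walk, but a bag with \<open>Center\<close> already yields the bound 1.\<close>
    obtain x where "x \<in> set P" "Center \<in> \<beta> x"
      using dec pverts_s_claw_iff(3)[of G] unfolding path_decomposition_def by auto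
    then have "card {Center :: 'a s_vertex} \<le> alpha_pw (s_claw G)"
      by (intro independent_card_le[of x]) (auto simp: parcs_s_claw_iff[OF G])
    with True show ?thesis by simp
  next
    case False
    obtain a b c where abc: "{a, b, c} = {1, 2, 3}" "a \<noteq> b" "b \<noteq> c" "p a \<le> p b" "p b \<le> p c"
      by (rule median_of_three)
    then have mem: "a \<in> {1, 2, 3}" "b \<in> {1, 2, 3}" "c \<in> {1, 2, 3}" by blast+
    have "T a \<noteq> {}" "T c \<noteq> {}"
      using False pT(5)[OF mem(1)] pT(5)[OF mem(3)] by auto
    then obtain u v where u: "u \<in> T a" and v: "v \<in> T c" by blast
    have bag: "Copy a u \<in> \<beta> (P ! p a)" "Copy c v \<in> \<beta> (P ! p c)"
      using pT(2)[OF mem(1)] pT(2)[OF mem(3)] u v by auto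
    then have "Copy a u \<in> pverts (s_claw G)" "Copy c v \<in> pverts (s_claw G)"
      using dec pT(1)[OF mem(1)] pT(1)[OF mem(3)]
      unfolding path_decomposition_def by (auto dest!: nth_mem)
    then have verts: "u \<in> pverts G" "v \<in> pverts G"
      by (simp_all add: pverts_s_claw_iff)
    \<comment> \<open>The vertices of the walk from copy \<open>a\<close> to copy \<open>c\<close>,
      which the bag at \<open>p b\<close> must meet.\<close>
    define C where "C = {Copy a u, Apex a, Center, Apex c, Copy c v}"
    let ?R = "Restr (arcs_ends (s_claw G)) C"
    have "(Copy a u, Apex a) \<in> ?R" "(Apex a, Center) \<in> ?R" "(Center, Apex c) \<in> ?R"
      "(Apex c, Copy c v) \<in> ?R"
      using mem verts by (simp_all add: C_def parcs_s_claw_iff[OF G])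
    then have "(Copy a u, Copy c v) \<in> ?R\<^sup>*"
      by (meson rtrancl.rtrancl_into_rtrancl rtrancl.rtrancl_refl)
    then have "\<beta> (P ! p b) \<inter> C \<noteq> {}"
      using path_decomposition_separates[OF dec _ _ bag abc(4,5) pT(1)[OF mem(3)], of C]
      by (simp add: C_def)
    then obtain z where z: "z \<in> \<beta> (P ! p b)" "z \<in> C" by blast
    \<comment> \<open>The walk avoids copy \<open>b\<close> and \<open>Apex b\<close>, so its
      vertices are distinct from and nonadjacent to those of copy \<open>b\<close>. Absence of loops
      in \<open>G\<close> settles \<open>(z, z)\<close> at the two ends.\<close>
    have z_b: "(z, Copy b y) \<notin> parcs (s_claw G)" "(Copy b y, z) \<notin> parcs (s_claw G)"
      "(z, z) \<notin> parcs (s_claw G)" "z \<noteq> Copy b y" for y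
      using z(2) abc(2,3) G.pair_no_loops[of "(u, u)"] G.pair_no_loops[of "(v, v)"]
      by (auto simp: C_def parcs_s_claw_iff[OF G])
    have "card (insert z (Copy b ` T b)) \<le> alpha_pw (s_claw G)"
      using z(1) z_b pT(1-4)[OF mem(2)]
      by (intro independent_card_le[of "P ! p b"]) (auto simp: parcs_s_claw_iff[OF G])
    moreover have "card (insert z (Copy b ` T b)) = card (T b) + 1"
      using z_b(4) pT(3)[OF mem(2)] by (subst card_insert_disjoint) (auto simp: card_image inj_on_def)
    ultimately show ?thesis
      using pT(5)[OF mem(2)] by simp
  qed
qed

theorem theorem4p1:
  fixes G :: "'a pair_pre_digraph"
  assumes "pair_graph G"
  shows "alpha_pw (with_proj (s_claw G)) = alpha_pw (with_proj G) + 1"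
  using alpha_pw_s_claw_le[OF assms] alpha_pw_s_claw_ge[OF assms] by (rule antisym)

end
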